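(* For integers $k\ge 1$, $c$ and $n$ the following inequalities hold: (i) $2^{k/2-1} \le \mathrm{wsat}(n,k) \le \mathrm{sat}(n,k)$ provided $k \le n$; (ii) $\frac{2^{k+c}}{(k+c)^{c+1}} \le \mathrm{wsat}(k+c,k) \le \mathrm{sat}(k+c,k)$ provided $2 \le k$ and $0 \le c$.
   Context: Write $[n]=\{1,\dots,n\}$ and let $2^{[n]}$ be its power set. For positive integers $k,n$ and a family $\mathcal F\subseteq 2^{[n]}$ consider the two properties: (1) there do not exist $k+1$ distinct sets $F_1,\dots,F_{k+1}\in\mathcal F$ forming a $(k+1)$-chain $F_1\subset F_2\subset\dots\subset F_{k+1}$; (2) for every $S\in 2^{[n]}\setminus\mathcal F$ there exist $k$ distinct sets $F_1,\dots,F_k\in\mathcal F$ such that $S$ together with $F_1,\dots,F_k$ forms a $(k+1)$-chain (i.e. these $k+1$ distinct sets are totally ordered by inclusion). The family $\mathcal F$ is weakly saturating $k$-Sperner if it satisfies (2), and (strongly) saturating $k$-Sperner if it satisfies both (1) and (2). Let $\mathrm{sat}(n,k)$ (respectively $\mathrm{wsat}(n,k)$) denote the minimum number of sets in a strongly saturating (respectively weakly saturating) $k$-Sperner family $\mathcal F\subseteq 2^{[n]}$. *)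

theory Defs
  imports Complex_Main
begin

(* chain_subset, from HOL.Zorn, says that a family is totally ordered by inclusion;
   an m-chain is such a family with m members, so its members are automatically distinct. *)
definition set_chain :: "nat \<Rightarrow> 'a set set \<Rightarrow> bool" where
  "set_chain m C \<longleftrightarrow> finite C \<and> card C = m \<and> chain_subset C"

definition sperner :: "nat \<Rightarrow> 'a set set \<Rightarrow> bool" where
  "sperner k \<F> \<longleftrightarrow> \<not> (\<exists>C \<subseteq> \<F>. set_chain (k + 1) C)"

(* C has k members: S is not in \<F>, so insert S C has exactly one member more than C. *)
definition weakly_saturating :: "nat \<Rightarrow> nat \<Rightarrow> nat set set \<Rightarrow> bool" where
  "weakly_saturating n k \<F> \<longleftrightarrow> \<F> \<subseteq> Pow {1..n} \<and>
     (\<forall>S \<in> Pow {1..n} - \<F>. \<exists>C \<subseteq> \<F>. set_chain (k + 1) (insert S C))"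

definition strongly_saturating :: "nat \<Rightarrow> nat \<Rightarrow> nat set set \<Rightarrow> bool" where
  "strongly_saturating n k \<F> \<longleftrightarrow> sperner k \<F> \<and> weakly_saturating n k \<F>"

(* Min is specified only on finite nonempty sets; the lemmas below show that these are. *)
definition wsat :: "nat \<Rightarrow> nat \<Rightarrow> nat" where
  "wsat n k = Min (card ` {\<F>. weakly_saturating n k \<F>})"

definition sat :: "nat \<Rightarrow> nat \<Rightarrow> nat" where
  "sat n k = Min (card ` {\<F>. strongly_saturating n k \<F>})"

lemma finite_weakly_saturating: "finite {\<F>. weakly_saturating n k \<F>}"
  by (rule finite_subset[of _ "Pow (Pow {1..n})"])
    (simp_all add: weakly_saturating_def subset_iff)

lemma finite_strongly_saturating: "finite {\<F>. strongly_saturating n k \<F>}"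
  by (rule finite_subset[OF _ finite_weakly_saturating[of n k]])
    (simp add: strongly_saturating_def subset_iff)

lemma strongly_saturating_exists: "\<exists>\<F>. strongly_saturating n k \<F>"
proof -
  define A where "A = {\<F>. \<F> \<subseteq> Pow {1..n} \<and> sperner k \<F>}"
  have "finite A"
    unfolding A_def by (rule finite_subset[of _ "Pow (Pow {1..n})"]) auto
  moreover have "{} \<in> A"
    by (simp add: A_def sperner_def set_chain_def)
  ultimately obtain \<F> where \<F>: "\<F> \<in> A" and
    max: "\<forall>\<G>\<in>A. \<F> \<subseteq> \<G> \<longrightarrow> \<F> = \<G>"
    using finite_has_maximal[of A] by (metis empty_iff)
  have "\<exists>C \<subseteq> \<F>. set_chain (k + 1) (insert S C)" if S: "S \<in> Pow {1..n} - \<F>" for S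
  proof -
    have "insert S \<F> \<notin> A"
    proof
      assume "insert S \<F> \<in> A"
      then have "\<F> = insert S \<F>"
        using max by (meson subset_insertI)
      then show False
        using S by blast
    qed
    moreover have "insert S \<F> \<subseteq> Pow {1..n}"
      using S \<F> unfolding A_def by blast
    ultimately have "\<not> sperner k (insert S \<F>)"
      unfolding A_def by blast
    then obtain D where D: "D \<subseteq> insert S \<F>" "set_chain (k + 1) D"
      unfolding sperner_def by blast
    have "sperner k \<F>"
      using \<F> unfolding A_def by blast
    then have "\<not> D \<subseteq> \<F>"
      using D(2) unfolding sperner_def by blast
    then have "S \<in> D"
      using D(1) by blast
    then have "insert S (D - {S}) = D"
      by (rule insert_Diff)
    moreover have "D - {S} \<subseteq> \<F>"
      using D(1) by blast
    ultimately show ?thesis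
      using D(2) by metis
  qed
  moreover have "\<F> \<subseteq> Pow {1..n}" "sperner k \<F>"
    using \<F> unfolding A_def by blast+
  ultimately show ?thesis
    unfolding strongly_saturating_def weakly_saturating_def by blast
qed

end

theory Submission
  imports Defs
begin

text \<open>
  Let \<open>\<F>\<close> be weakly saturating. Every \<open>S\<close> outside \<open>\<F>\<close> comes with \<open>k\<close> members of \<open>\<F>\<close> that
  are comparable with \<open>S\<close> and have distinct sizes; both bounds double count pairs \<open>(S, T)\<close>
  with \<open>T \<in> \<F>\<close> one of these members.

  (i) With \<open>t = (k - 2) div 2\<close>, at most \<open>t\<close> of these members lie below \<open>S\<close> with fewer than \<open>t\<close>
  elements, and at most \<open>t\<close> lie above \<open>S\<close> with fewer than \<open>t\<close> elements missing. At least
  \<open>k - 2t\<close> members remain, and a set \<open>T\<close> can play that role for at most about \<open>2 ^ (n - t)\<close>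
  sets \<open>S\<close> on either side.

  (ii) If \<open>n = k + c\<close>, the chain misses only \<open>c\<close> of the \<open>n + 1\<close> sizes, so some member is at
  distance at most \<open>c + 1\<close> from \<open>S\<close>. Balls of radius \<open>c + 1\<close> have at most \<open>n ^ (c + 1)\<close>
  elements if \<open>c \<ge> 1\<close>. If \<open>c = 0\<close>, every \<open>S \<notin> \<F>\<close> apart from the empty and the full set has two
  neighbours in \<open>\<F>\<close>.
\<close>

section \<open>Double counting and sizes of Hamming balls\<close>

lemma chain_subset_inj_on_card:
  assumes "chain_subset C" "\<And>T. T \<in> C \<Longrightarrow> finite T"
  shows "inj_on card C"
  using assms unfolding chain_subset_def inj_on_def by (metis card_subset_eq)

lemma double_count_le:
  assumes "finite A" "finite B"
    and "\<And>x. x \<in> A \<Longrightarrow> m \<le> card {y \<in> B. R x y}"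
    and "\<And>y. y \<in> B \<Longrightarrow> card {x \<in> A. R x y} \<le> M"
  shows "m * card A \<le> M * card B"
proof -
  have "m * card A \<le> (\<Sum>x\<in>A. card {y \<in> B. R x y})"
    using sum_mono[of A "\<lambda>_. m" "\<lambda>x. card {y \<in> B. R x y}"] assms(3) by (simp add: mult.commute)
  also have "\<dots> = (\<Sum>y\<in>B. card {x \<in> A. R x y})"
    using sum.swap_restrict[OF assms(1,2), of "\<lambda>_ _. 1::nat" R] by simp
  also have "\<dots> \<le> M * card B"
    using sum_mono[of B "\<lambda>y. card {x \<in> A. R x y}" "\<lambda>_. M"] assms(4) by (simp add: mult.commute)
  finally show ?thesis .
qed

text \<open>The exponent starts at 2 because a ball of radius 1 has n + 1 > n points. In the
  induction step, absorption bounds the new binomial by n - 1 times the previous one, so the sum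
  grows at most by the factor n.\<close>

lemma sum_choose_le_power:
  assumes "2 \<le> (n::nat)"
  shows "(\<Sum>j\<le>m+2. n choose j) \<le> n ^ (m + 2)"
proof (induction m)
  case 0
  \<comment> \<open>The base case 1 + n + n(n - 1)/2 \<le> n^2 is equivalent to this.\<close>
  have "n + 2 \<le> n * n"
    using assms mult_le_mono1[of 2 n n] by linarith
  moreover have "2 * (n choose 2) + n = n * n"
    using assms by (simp add: choose_two diff_mult_distrib2)
  ultimately show ?case
    by (simp add: numeral_2_eq_2)
next
  case (Suc m)
  have "Suc (m + 2) * (n choose Suc (m + 2)) = (n - (m + 2)) * (n choose (m + 2))"
    by (metis binomial_absorb_comp binomial_absorption mult.commute)
  then have "n choose Suc (m + 2) \<le> (n - (m + 2)) * (n choose (m + 2))"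
    by (metis le_add1 mult_Suc)
  also have "\<dots> \<le> (n - 1) * n ^ (m + 2)"
  proof (rule mult_le_mono)
    show "n choose (m + 2) \<le> n ^ (m + 2)"
      using Suc member_le_sum[of "m + 2" "{..m+2}" "\<lambda>j. n choose j"] by simp
  qed simp
  finally have "n choose Suc (m + 2) \<le> (n - 1) * n ^ (m + 2)" .
  then have "(\<Sum>j\<le>Suc m+2. n choose j) \<le> n ^ (m + 2) + (n - 1) * n ^ (m + 2)"
    using Suc by simp
  also have "\<dots> = n ^ (Suc m + 2)"
    using assms by (cases n) auto
  finally show ?case .
qed

lemma card_subsets_card_le:
  assumes "finite X"
  shows "card {D. D \<subseteq> X \<and> card D \<le> m} = (\<Sum>j\<le>m. card X choose j)"
proof -
  have "{D. D \<subseteq> X \<and> card D \<le> m} = (\<Union>j\<in>{..m}. {D. D \<subseteq> X \<and> card D = j})"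
    by auto
  also have "card \<dots> = (\<Sum>j\<le>m. card {D. D \<subseteq> X \<and> card D = j})"
    by (rule card_UN_disjoint) (use assms in auto)
  finally show ?thesis
    using assms by (simp add: n_subsets)
qed

text \<open>The map taking S to its symmetric difference with F is injective, so a ball around any F
  is no larger than the ball around the empty set.\<close>

lemma card_le_by_sym_diff:
  assumes "finite X" "F \<subseteq> X" "\<And>S. S \<in> A \<Longrightarrow> S \<subseteq> X \<and> sym_diff S F \<in> \<D>" "finite \<D>"
  shows "card A \<le> card \<D>"
proof (rule card_inj_on_le[OF _ _ assms(4)])
  show "inj_on (\<lambda>S. sym_diff S F) A"
    unfolding inj_on_def by blast
qed (use assms(3) in auto)

section \<open>Chains supplied by weak saturation\<close>

text \<open>Members of a chain of finite sets have distinct sizes, so later arguments count sizes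
  instead of sets. As S is outside \<F>, it is not in C, and C keeps exactly k members.\<close>

lemma weakly_saturating_chain:
  assumes "weakly_saturating n k \<F>" "S \<subseteq> {1..n}" "S \<notin> \<F>"
  obtains C where "C \<subseteq> \<F>" "finite C" "card C = k" "inj_on card (insert S C)"
    "\<And>T. T \<in> C \<Longrightarrow> T \<subset> S \<or> S \<subset> T"
proof -
  obtain C where C: "C \<subseteq> \<F>" "set_chain (k + 1) (insert S C)"
    using assms unfolding weakly_saturating_def by blast
  have "S \<notin> C"
    using C(1) assms(3) by blast
  have "finite T" if "T \<in> insert S C" for T
    using that C(1) assms unfolding weakly_saturating_def
    by (metis PowD finite_atLeastAtMost finite_subset insert_iff subset_iff)
  then have "inj_on card (insert S C)"
    using C(2) chain_subset_inj_on_card unfolding set_chain_def by blast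
  moreover have "T \<subset> S \<or> S \<subset> T" if "T \<in> C" for T
    using C(2) that \<open>S \<notin> C\<close> unfolding set_chain_def chain_subset_def by blast
  ultimately show ?thesis
    using that[of C] C \<open>S \<notin> C\<close> unfolding set_chain_def by (metis Suc_eq_plus1 card_insert_disjoint diff_Suc_1 finite_insert)
qed

lemma weakly_saturating_subset:
  assumes "weakly_saturating n k \<F>"
  shows "\<F> \<subseteq> Pow {1..n}" "finite \<F>"
  using assms finite_subset[of \<F> "Pow {1..n}"] unfolding weakly_saturating_def by auto

lemma card_Pow_diff:
  assumes "\<F> \<subseteq> Pow {1..n::nat}"
  shows "card (Pow {1..n} - \<F>) + card \<F> = 2 ^ n"
  using card_Un_disjoint[of "Pow {1..n} - \<F>" \<F>] finite_subset[OF assms] assms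
  by (simp add: card_Pow Un_absorb2 Int_commute)

lemma weakly_saturating_card_ge:
  assumes "weakly_saturating n k \<F>" "k \<le> n"
  shows "k \<le> card \<F>"
proof (cases "\<F> = Pow {1..n}")
  case True
  then show ?thesis
    using assms(2) less_exp[of n] by (simp add: card_Pow del: less_exp)
next
  case False
  then obtain S where "S \<subseteq> {1..n}" "S \<notin> \<F>"
    using weakly_saturating_subset[OF assms(1)] by blast
  then obtain C where "C \<subseteq> \<F>" "card C = k"
    using weakly_saturating_chain[OF assms(1)] by metis
  then show ?thesis
    using card_mono weakly_saturating_subset[OF assms(1)] by blast
qed

section \<open>The exponential bound, independent of n\<close>

lemma weakly_saturating_exponential:
  assumes ws: "weakly_saturating n k \<F>" and "k \<le> n" and t: "2 * t + 2 \<le> k" "k \<le> 2 * t + 3"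
  shows "(k - 2 * t) * 2 ^ t \<le> 2 * card \<F>"
proof -
  define A where "A = Pow {1..n} - \<F>"
  define R where "R S T \<longleftrightarrow> T \<subset> S \<and> t \<le> card T \<or> S \<subset> T \<and> t \<le> n - card T" for S T :: "nat set"
  note \<F> = weakly_saturating_subset[OF ws]
  have finA: "finite A"
    unfolding A_def by simp
  have "k - 2 * t \<le> card {T \<in> \<F>. R S T}" if "S \<in> A" for S
  proof -
    obtain C where C: "C \<subseteq> \<F>" "finite C" "card C = k" "inj_on card (insert S C)"
      "\<And>T. T \<in> C \<Longrightarrow> T \<subset> S \<or> S \<subset> T"
      using weakly_saturating_chain[OF ws] \<open>S \<in> A\<close> unfolding A_def by (metis DiffE PowD)
    have inj: "inj_on card C"
      using C(4) by simp
    define L U where "L = {T \<in> C. card T < t}" and "U = {T \<in> C. n - card T < t}"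
    have "card L \<le> card {..<t}"
      by (rule card_inj_on_le[of card]) (use inj in \<open>auto simp: L_def inj_on_def\<close>)
    moreover have "card U \<le> card {..<t}"
    proof (rule card_inj_on_le[of "\<lambda>T. n - card T"])
      have "card T \<le> n" if "T \<in> C" for T
        using that C(1) \<F>(1) card_mono[of "{1..n}" T] by auto
      then show "inj_on (\<lambda>T. n - card T) U"
        using inj unfolding U_def inj_on_def by (metis (no_types, lifting) diff_diff_cancel mem_Collect_eq)
    qed (auto simp: U_def)
    \<comment> \<open>A chain member failing R lies below S with size under t, hence in L, or above
      S with fewer than t elements missing, hence in U.\<close>
    moreover have "card C \<le> card ({T \<in> \<F>. R S T} \<union> (L \<union> U))"
      by (rule card_mono) (use C \<F> in \<open>force simp: L_def U_def R_def\<close>)+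
    moreover have "\<dots> \<le> card {T \<in> \<F>. R S T} + (card L + card U)"
      by (meson add_left_mono card_Un_le le_trans)
    ultimately show ?thesis
      using C(3) by simp
  qed
  \<comment> \<open>Subtracting k - 2t here lets the sets of \<F> join those of A after the double
    count, so that the left side becomes a multiple of 2^n.\<close>
  moreover have "card {S \<in> A. R S T} \<le> 2 ^ (n - t + 1) - (k - 2 * t)" if "T \<in> \<F>" for T
  proof -
    have T: "T \<subseteq> {1..n}" "finite T" "card T \<le> n"
      using that \<F>(1) card_mono[of "{1..n}" T] by (auto intro: finite_subset)
    define up where "up = {S. t \<le> card T \<and> T \<subset> S \<and> S \<subseteq> {1..n}}"
    define down where "down = {S. t \<le> n - card T \<and> S \<subset> T}"
    have "card {S \<in> A. R S T} \<le> card (up \<union> down)"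
      by (rule card_mono, rule finite_subset[of _ "Pow {1..n}"])
        (use T in \<open>auto simp: up_def down_def R_def A_def\<close>)
    also have "\<dots> \<le> card up + card down"
      by (rule card_Un_le)
    finally have le: "card {S \<in> A. R S T} \<le> card up + card down" .
    have up: "card up + 1 \<le> 2 ^ (n - card T)"
    proof -
      have "card up \<le> card (Pow ({1..n} - T) - {{}})"
        by (rule card_inj_on_le[of "\<lambda>S. S - T"]) (auto simp: up_def inj_on_def)
      also have "\<dots> = 2 ^ (n - card T) - 1"
        using T by (simp add: card_Pow card_Diff_subset)
      finally show ?thesis
        using zero_less_power[of "2::nat" "n - card T"] by linarith
    qed
    have down: "card down + 1 \<le> 2 ^ card T"
    proof -
      have "card down \<le> card (Pow T - {T})"
        by (rule card_mono) (use T in \<open>auto simp: down_def\<close>)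
      also have "\<dots> = 2 ^ card T - 1"
        using T by (simp add: card_Pow)
      finally show ?thesis
        using zero_less_power[of "2::nat" "card T"] by linarith
    qed
    have pow: "(2::nat) ^ (n - t + 1) = 2 * 2 ^ (n - t)" "(2::nat) ^ (n - t) = 2 * 2 ^ (n - t - 1)"
      using t \<open>k \<le> n\<close> by (simp_all flip: power_Suc add: Suc_diff_Suc)
    have "(2::nat) ^ 1 \<le> 2 ^ (n - t - 1)"
      by (rule power_increasing) (use t \<open>k \<le> n\<close> in auto)
    then have two: "2 \<le> (2::nat) ^ (n - t - 1)"
      by simp
    have mono: "(2::nat) ^ i \<le> 2 ^ j" if "i \<le> j" for i j
      using that by simp
    \<comment> \<open>Since 2t + 2 \<le> n, the sizes of T and of its complement cannot both equal
      t. In each case one of \<open>up\<close> and \<open>down\<close> is empty or one exponent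
      drops to n - t - 1. This leaves slack 3, which is the largest possible value of k -
      2t.\<close>
    consider "card T < t" | "n - card T < t" | "t < card T" "t \<le> n - card T"
      | "t \<le> card T" "t < n - card T"
      using t \<open>k \<le> n\<close> by linarith
    then have "card up + card down + 3 \<le> 2 ^ (n - t + 1)"
    proof cases
      case 1
      then have "card up = 0" "(2::nat) ^ card T \<le> 2 ^ (n - t - 1)"
        using t \<open>k \<le> n\<close> by (auto simp: up_def)
      then show ?thesis
        using down two pow by linarith
    next
      case 2
      then have "card down = 0" "(2::nat) ^ (n - card T) \<le> 2 ^ (n - t - 1)"
        using t \<open>k \<le> n\<close> by (auto simp: down_def)
      then show ?thesis
        using up two pow by linarith
    next
      case 3
      then have "(2::nat) ^ card T \<le> 2 ^ (n - t)" "(2::nat) ^ (n - card T) \<le> 2 ^ (n - t - 1)"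
        using T(3) by (auto intro!: mono)
      then show ?thesis
        using up down two pow by linarith
    next
      case 4
      then have "(2::nat) ^ card T \<le> 2 ^ (n - t - 1)" "(2::nat) ^ (n - card T) \<le> 2 ^ (n - t)"
        using T(3) by (auto intro!: mono)
      then show ?thesis
        using up down two pow by linarith
    qed
    then show ?thesis
      using le t by linarith
  qed
  ultimately have "(k - 2 * t) * card A \<le> (2 ^ (n - t + 1) - (k - 2 * t)) * card \<F>"
    by (rule double_count_le[OF finA \<F>(2)])
  \<comment> \<open>Hence the natural-number subtraction above does not truncate.\<close>
  moreover have "k - 2 * t \<le> 2 ^ (n - t + 1)"
  proof -
    have "(2::nat) ^ 2 \<le> 2 ^ (n - t + 1)"
      by (rule power_increasing) (use t \<open>k \<le> n\<close> in auto)
    then show ?thesis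
      using t by simp
  qed
  then have "(2 ^ (n - t + 1) - (k - 2 * t)) * card \<F> + (k - 2 * t) * card \<F> = 2 ^ (n - t + 1) * card \<F>"
    by (metis add_mult_distrib le_add_diff_inverse2)
  ultimately have "(k - 2 * t) * (card A + card \<F>) \<le> 2 ^ (n - t + 1) * card \<F>"
    unfolding add_mult_distrib2 by linarith
  then have "(k - 2 * t) * 2 ^ n \<le> 2 ^ (n - t + 1) * card \<F>"
    using card_Pow_diff[OF \<F>(1)] unfolding A_def by simp
  moreover have "(2::nat) ^ n = 2 ^ (n - t) * 2 ^ t"
    using t \<open>k \<le> n\<close> by (simp flip: power_add)
  ultimately have "2 ^ (n - t) * ((k - 2 * t) * 2 ^ t) \<le> 2 ^ (n - t) * (2 * card \<F>)"
    by (simp add: ac_simps)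
  then show ?thesis
    by simp
qed

section \<open>The ball bound for n = k + c\<close>

text \<open>Otherwise the chain through S avoids the size of S and the next c + 1 sizes on either
  side. If c + 1 sizes fit on one side, this forbids c + 2 of the k + c + 1 sizes and leaves only k
  - 1 for k members.\<close>

lemma weakly_saturating_near:
  assumes ws: "weakly_saturating (k + c) k \<F>" and "1 \<le> k" and S: "S \<subseteq> {1..k + c}" "S \<notin> \<F>"
  shows "\<exists>T\<in>\<F>. card (sym_diff S T) \<le> c + 1"
proof (rule ccontr)
  assume far: "\<not> ?thesis"
  let ?n = "k + c" and ?s = "card S"
  have finS: "finite S"
    using S(1) by (rule finite_subset) simp
  have s: "?s \<le> ?n"
    using card_mono[OF _ S(1)] by simp
  obtain C where C: "C \<subseteq> \<F>" "finite C" "card C = k" "inj_on card (insert S C)"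
    "\<And>T. T \<in> C \<Longrightarrow> T \<subset> S \<or> S \<subset> T"
    using weakly_saturating_chain[OF ws S] by metis
  have sizes: "card T \<le> ?n \<and> (card T + (c + 1) < ?s \<or> ?s + (c + 1) < card T)" if "T \<in> C" for T
  proof -
    have T: "T \<subseteq> {1..?n}" "finite T"
      using that C(1) weakly_saturating_subset(1)[OF ws] by (auto intro: finite_subset)
    have "c + 1 < card (sym_diff S T)"
      using far that C(1) by (metis not_le subsetD)
    moreover have "card (sym_diff S T) = ?s - card T" if "T \<subset> S"
      using that finS T by (simp add: psubset_eq Diff_eq_empty_iff[THEN iffD2] card_Diff_subset)
    moreover have "card (sym_diff S T) = card T - ?s" if "S \<subset> T"
      using that finS T by (simp add: psubset_eq Diff_eq_empty_iff[THEN iffD2] card_Diff_subset)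
    ultimately show ?thesis
      using C(5)[OF that] card_mono[OF _ T(1)] by fastforce
  qed
  have bound: "k \<le> card ({0..?n} - I)" if "\<And>T. T \<in> C \<Longrightarrow> card T \<notin> I" for I
  proof -
    have "card ` C \<subseteq> {0..?n} - I"
      using sizes that by auto
    then show ?thesis
      using C(3,4) card_image[of card C] card_mono[of "{0..?n} - I" "card ` C"] by simp
  qed
  consider "c + 1 \<le> ?s" | "?s + (c + 1) \<le> ?n" | "?s < c + 1" "?n < ?s + (c + 1)"
    by linarith
  then show False
  proof cases
    case 1
    then have "card ({0..?n} - {?s - (c + 1)..?s}) + (c + 2) = ?n + 1"
      using s by (subst card_Diff_subset) auto
    moreover have "k \<le> card ({0..?n} - {?s - (c + 1)..?s})"
      by (rule bound) (use sizes in fastforce)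
    ultimately show False
      by simp
  next
    case 2
    then have "card ({0..?n} - {?s..?s + (c + 1)}) + (c + 2) = ?n + 1"
      by (subst card_Diff_subset) auto
    moreover have "k \<le> card ({0..?n} - {?s..?s + (c + 1)})"
      by (rule bound) (use sizes in fastforce)
    ultimately show False
      by simp
  next
    \<comment> \<open>Neither side has room for c + 1 further sizes, so every size from 0 to n is
      too close to that of S.\<close>
    case 3
    then have "C = {}"
      using sizes by fastforce
    then show False
      using C(3) \<open>1 \<le> k\<close> by simp
  qed
qed

lemma weakly_saturating_ball_bound:
  assumes ws: "weakly_saturating (k + c) k \<F>" and "1 \<le> k" "1 \<le> c"
  shows "2 ^ (k + c) \<le> (k + c) ^ (c + 1) * card \<F>"
proof -
  let ?n = "k + c"
  let ?D = "{D. D \<subseteq> {1..?n} \<and> card D \<le> c + 1}"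
  note \<F> = weakly_saturating_subset[OF ws]
  have "1 * card (Pow {1..?n}) \<le> card ?D * card \<F>"
  proof (rule double_count_le[where R = "\<lambda>S T. card (sym_diff S T) \<le> c + 1"])
    fix S assume S: "S \<in> Pow {1..?n}"
    have "\<exists>T\<in>\<F>. card (sym_diff S T) \<le> c + 1"
    proof (cases "S \<in> \<F>")
      case True
      then show ?thesis
        by (intro bexI[of _ S]) auto
    next
      case False
      then show ?thesis
        using weakly_saturating_near[OF ws \<open>1 \<le> k\<close>] S by blast
    qed
    then have "{T \<in> \<F>. card (sym_diff S T) \<le> c + 1} \<noteq> {}"
      by blast
    then show "1 \<le> card {T \<in> \<F>. card (sym_diff S T) \<le> c + 1}"
      using \<F>(2) by (simp add: Suc_le_eq card_gt_0_iff)
  next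
    fix T assume "T \<in> \<F>"
    then show "card {S \<in> Pow {1..?n}. card (sym_diff S T) \<le> c + 1} \<le> card ?D"
      by (intro card_le_by_sym_diff[of "{1..?n}" T]) (use \<F>(1) in auto)
  qed (use \<F> in auto)
  \<comment> \<open>As c \<ge> 1, the radius (c - 1) + 2 is c + 1.\<close>
  moreover have "card ?D \<le> ?n ^ (c + 1)"
    using sum_choose_le_power[of ?n "c - 1"] assms(2,3) card_subsets_card_le[of "{1..?n}" "c + 1"]
    by simp
  ultimately show ?thesis
    using mult_le_mono1[of "card ?D" "?n ^ (c + 1)" "card \<F>"]
    by (simp add: card_Pow le_trans del: power_Suc)
qed

section \<open>The case c = 0\<close>

text \<open>The k + 1 sizes in the chain through S fill {0..k}, so the sizes just below and just
  above that of S occur. Both exist because S is neither empty nor full.\<close>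

lemma weakly_saturating_neighbours:
  assumes ws: "weakly_saturating k k \<F>" and S: "S \<subset> {1..k}" "S \<noteq> {}" "S \<notin> \<F>"
  shows "2 \<le> card {T \<in> \<F>. card (sym_diff S T) = 1}"
proof -
  let ?s = "card S"
  have finS: "finite S"
    using S(1) finite_subset by blast
  have s: "?s < k" "0 < ?s"
    using psubset_card_mono[OF _ S(1)] S(2) finS by (auto simp: card_gt_0_iff)
  obtain C where C: "C \<subseteq> \<F>" "finite C" "card C = k" "inj_on card (insert S C)"
    "\<And>T. T \<in> C \<Longrightarrow> T \<subset> S \<or> S \<subset> T"
    using weakly_saturating_chain[OF ws _ S(3)] S(1) by (metis psubset_imp_subset)
  have sub: "T \<subseteq> {1..k}" "finite T" if "T \<in> C" for T
    using that C(1) weakly_saturating_subset(1)[OF ws] by (auto intro: finite_subset)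
  have "S \<notin> C"
    using C(5) by blast
  have "card ` insert S C \<subseteq> {0..k}"
    using sub card_mono[of "{1..k}"] s by fastforce
  moreover have "card (card ` insert S C) = card {0..k}"
    using card_image[OF C(4)] C(2,3) \<open>S \<notin> C\<close> by simp
  ultimately have all: "card ` insert S C = {0..k}"
    by (simp add: card_subset_eq)
  have "?s - 1 \<in> card ` insert S C" "?s + 1 \<in> card ` insert S C"
    unfolding all using s by auto
  then obtain T U where TU: "T \<in> C" "card T = ?s - 1" "U \<in> C" "card U = ?s + 1"
    using s by auto
  have "T \<subset> S"
    using C(5)[OF TU(1)] psubset_card_mono[OF sub(2)[OF TU(1)], of S] TU(2) by (metis diff_le_self not_le)
  moreover have "S \<subset> U"
    using C(5)[OF TU(3)] psubset_card_mono[OF finS, of U] TU(4) by (metis le_add1 not_le)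
  ultimately have "sym_diff S T = S - T" "sym_diff S U = U - S"
    by auto
  then have "card (sym_diff S T) = 1" "card (sym_diff S U) = 1"
    using TU s finS \<open>T \<subset> S\<close> \<open>S \<subset> U\<close> sub by (simp_all add: card_Diff_subset psubset_imp_subset)
  then have "{T, U} \<subseteq> {T \<in> \<F>. card (sym_diff S T) = 1}"
    using TU C(1) by blast
  moreover have "card {T, U} = 2"
    using TU by (auto simp: card_insert_if)
  ultimately show ?thesis
    using card_mono[of "{T \<in> \<F>. card (sym_diff S T) = 1}" "{T, U}"]
      weakly_saturating_subset(2)[OF ws] by simp
qed

text \<open>Covering by balls of radius 1 would give only the factor k + 1. Two neighbours per
  missing set give 2(2^k - |\<F>| - 2) \<le> k|\<F>|, and 2|\<F>| + 4 \<le> k|\<F>| absorbs the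
  loss.\<close>

lemma weakly_saturating_full_length_bound:
  assumes ws: "weakly_saturating k k \<F>" and "2 \<le> k"
  shows "2 ^ k \<le> k * card \<F>"
proof -
  note \<F> = weakly_saturating_subset[OF ws]
  have N: "k \<le> card \<F>"
    using weakly_saturating_card_ge[OF ws] by simp
  show ?thesis
  proof (cases "k \<le> 4")
    case True
    \<comment> \<open>These are exactly the k \<ge> 2 with 2^k \<le> k^2, where |\<F>| \<ge> k is
      already enough.\<close>
    then have "k = 2 \<or> k = 3 \<or> k = 4"
      using assms(2) by auto
    then have "2 ^ k \<le> k * k"
      by auto
    then show ?thesis
      using N le_trans mult_le_mono2 by blast
  next
    case False
    let ?A = "Pow {1..k} - \<F>" and ?D = "{D. D \<subseteq> {1..k} \<and> card D = 1}"
    have "2 * card (?A - {{}, {1..k}}) \<le> k * card \<F>"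
    proof (rule double_count_le[where R = "\<lambda>S T. card (sym_diff S T) = 1"])
      fix S assume "S \<in> ?A - {{}, {1..k}}"
      then show "2 \<le> card {T \<in> \<F>. card (sym_diff S T) = 1}"
        by (intro weakly_saturating_neighbours[OF ws]) auto
    next
      fix T assume "T \<in> \<F>"
      then have "card {S \<in> ?A - {{}, {1..k}}. card (sym_diff S T) = 1} \<le> card ?D"
        by (intro card_le_by_sym_diff[of "{1..k}" T]) (use \<F>(1) in auto)
      then show "card {S \<in> ?A - {{}, {1..k}}. card (sym_diff S T) = 1} \<le> k"
        by (simp add: n_subsets)
    qed (use \<F> in auto)
    moreover have "card ?A \<le> card (?A - {{}, {1..k}}) + 2"
      using diff_card_le_card_Diff[of "{{}, {1..k}}" ?A] card_insert_le_m1[of 2 "{{1..k}}" "{}"]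
      by simp
    moreover have "card ?A + card \<F> = 2 ^ k"
      using card_Pow_diff[OF \<F>(1)] .
    moreover have "2 * card \<F> + 4 \<le> k * card \<F>"
      using N False mult_le_mono1[of 3 k "card \<F>"] by linarith
    ultimately show ?thesis
      by linarith
  qed
qed

section \<open>Transfer to \<open>wsat\<close> and \<open>sat\<close>, with real exponents\<close>

lemma wsat_attained: "\<exists>\<F>. weakly_saturating n k \<F> \<and> card \<F> = wsat n k"
proof -
  have "{\<F>. weakly_saturating n k \<F>} \<noteq> {}"
    using strongly_saturating_exists[of n k] unfolding strongly_saturating_def by blast
  then have "wsat n k \<in> card ` {\<F>. weakly_saturating n k \<F>}"
    unfolding wsat_def by (intro Min_in finite_imageI finite_weakly_saturating) simp
  then show ?thesis
    by auto
qed

lemma wsat_le_sat: "wsat n k \<le> sat n k"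
  unfolding wsat_def sat_def
  by (rule Min_antimono)
    (use strongly_saturating_exists[of n k] finite_weakly_saturating[of n k] in
      \<open>auto simp: strongly_saturating_def\<close>)

lemma wsat_exponential_bound:
  assumes "1 \<le> k" "k \<le> n"
  shows "2 powr (real k / 2 - 1) \<le> real (wsat n k)"
proof -
  obtain \<F> where ws: "weakly_saturating n k \<F>" and card: "card \<F> = wsat n k"
    using wsat_attained by blast
  \<comment> \<open>The parity of k fixes t. For k = 1 there is no such t, but the bound is below 1
    and \<F> is nonempty.\<close>
  consider "k = 1" | t where "k = 2 * t + 2" | t where "k = 2 * t + 3"
  proof (cases "k = 1")
    case False
    then have "k = 2 * ((k - 2) div 2) + 2 \<or> k = 2 * ((k - 2) div 2) + 3"
      using assms(1) by presburger
    then show ?thesis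
      using that by blast
  qed
  then show ?thesis
  proof cases
    case 1
    have "(2::real) powr (real k / 2 - 1) \<le> 2 powr 0"
      using 1 by (intro powr_mono) auto
    moreover have "1 \<le> wsat n k"
      using weakly_saturating_card_ge[OF ws assms(2)] 1 card by simp
    ultimately show ?thesis
      by simp
  next
    case 2
    then have "2 ^ t \<le> wsat n k"
      using weakly_saturating_exponential[OF ws assms(2), of t] card by simp
    then have "(2::real) ^ t \<le> real (wsat n k)"
      by (metis of_nat_le_iff of_nat_numeral of_nat_power)
    moreover have "real k / 2 - 1 = real t"
      using 2 by (simp add: field_simps)
    ultimately show ?thesis
      by (simp add: powr_realpow)
  next
    case 3
    then have "3 * 2 ^ t \<le> 2 * wsat n k"
      using weakly_saturating_exponential[OF ws assms(2), of t] card by simp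
    then have "real (3 * 2 ^ t) \<le> real (2 * wsat n k)"
      by (rule of_nat_mono)
    then have "2 ^ t * (3 / 2) \<le> real (wsat n k)"
      by simp
    \<comment> \<open>For odd k the exponent is t + 1/2; the third chain member that remains gives
      the factor 3/2, which exceeds sqrt 2.\<close>
    moreover have "sqrt 2 \<le> 3 / 2"
      by (rule real_le_lsqrt) (simp_all add: power2_eq_square)
    then have "2 ^ t * sqrt 2 \<le> (2::real) ^ t * (3 / 2)"
      by simp
    moreover have "real k / 2 - 1 = real t + 1 / 2"
      using 3 by (simp add: field_simps)
    then have "2 powr (real k / 2 - 1) = 2 ^ t * sqrt 2"
      by (simp add: powr_add powr_realpow powr_half_sqrt)
    ultimately show ?thesis
      by linarith
  qed
qed

lemma wsat_bound_near_full_length: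
  assumes "2 \<le> k"
  shows "2 ^ (k + c) / real (k + c) ^ (c + 1) \<le> real (wsat (k + c) k)"
proof -
  obtain \<F> where ws: "weakly_saturating (k + c) k \<F>" and card: "card \<F> = wsat (k + c) k"
    using wsat_attained by blast
  have "2 ^ (k + c) \<le> (k + c) ^ (c + 1) * wsat (k + c) k"
  proof (cases "c = 0")
    case True
    then show ?thesis
      using weakly_saturating_full_length_bound[of k \<F>] ws card assms by simp
  next
    case False
    then show ?thesis
      using weakly_saturating_ball_bound[OF ws] card assms by simp
  qed
  then have "real (2 ^ (k + c)) \<le> real ((k + c) ^ (c + 1) * wsat (k + c) k)"
    by (rule of_nat_mono)
  then have "2 ^ (k + c) \<le> real (wsat (k + c) k) * real (k + c) ^ (c + 1)"
    by (simp add: mult.commute)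
  moreover have "0 < real (k + c) ^ (c + 1)"
    using assms by simp
  ultimately show ?thesis
    by (metis pos_divide_le_eq)
qed

theorem theorem3:
  fixes k c n :: nat
  assumes "1 \<le> k"
  shows "(k \<le> n \<longrightarrow>
            2 powr (real k / 2 - 1) \<le> real (wsat n k) \<and> wsat n k \<le> sat n k) \<and>
         (2 \<le> k \<longrightarrow>
            2 ^ (k + c) / real (k + c) ^ (c + 1) \<le> real (wsat (k + c) k) \<and>
            wsat (k + c) k \<le> sat (k + c) k)"
  using wsat_exponential_bound[OF assms] wsat_bound_near_full_length wsat_le_sat by blast

end
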